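(* Let $F$ be an $r$-graph with $\Delta(F)\ge 2$. If $p=p(n)$ satisfies $n^{-r}\ll p\ll n^{-\frac{1}{d_r(F)}}$, then a.a.s. $$\mathrm{ex}(G^r_{n,p},F)=(1+o(1))\,p\binom{n}{r}.$$ If $p=p(n)\le 1$ satisfies $p\gg n^{-\frac{1}{d_r(F)}}$, then a.a.s. $$\mathrm{ex}(G^r_{n,p},F)\ge \max\left\{\Omega(p\cdot \mathrm{ex}(n,F)),\ n^{r-\frac{1}{d_r(F)}}(\log n)^{-1}\right\}.$$
   Context: An $r$-graph is a finite $r$-uniform hypergraph; $v(F)$ is its number of vertices, $|F|$ its number of edges, $\Delta(F)$ its maximum vertex degree. For $|F|\ge 2$, $d_r(F)=\max_{F'\subseteq F,\ |F'|\ge 2}\frac{|F'|-1}{v(F')-r}$. $\mathrm{ex}(n,F)$ is the maximum number of edges in an $n$-vertex $F$-free $r$-graph. $G^r_{n,p}$ is the random $r$-graph on $n$ vertices in which each $r$-set is an edge independently with probability $p$. $\mathrm{ex}(G^r_{n,p},F)$ is the maximum number of edges in an $F$-free subgraph of $G^r_{n,p}$. Events $A_n$ hold a.a.s. if $\Pr[A_n]\to1$ as $n\to\infty$. $f(n)\ll g(n)$ (equivalently $g\gg f$) means $f(n)/g(n)\to0$. *)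

theory Defs
  imports "HOL-Probability.Product_PMF" "HOL-Library.Landau_Symbols"
begin

type_synonym 'a hgraph = "'a set \<times> 'a set set"

abbreviation verts :: "'a hgraph \<Rightarrow> 'a set" where "verts \<equiv> fst"
abbreviation edges :: "'a hgraph \<Rightarrow> 'a set set" where "edges \<equiv> snd"

definition rgraph :: "nat \<Rightarrow> 'a hgraph \<Rightarrow> bool" where
  "rgraph r F \<longleftrightarrow> finite (verts F) \<and> (\<forall>e\<in>edges F. e \<subseteq> verts F \<and> card e = r)"

definition subgraph :: "'a hgraph \<Rightarrow> 'a hgraph \<Rightarrow> bool" where
  "subgraph H G \<longleftrightarrow>
     verts H \<subseteq> verts G \<and> edges H \<subseteq> edges G \<and> (\<forall>e\<in>edges H. e \<subseteq> verts H)"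

definition vertex_degree :: "'a hgraph \<Rightarrow> 'a \<Rightarrow> nat" where
  "vertex_degree F v = card {e \<in> edges F. v \<in> e}"

text \<open>Inserting 0 only matters when there are no vertices, where the maximum degree is 0.\<close>

definition max_degree :: "'a hgraph \<Rightarrow> nat" where
  "max_degree F = Max (insert 0 (vertex_degree F ` verts F))"

text \<open>The \<open>r\<close>-density, meaningful for \<open>r\<close>-graphs with at least two edges; the denominators are
  then positive, since two distinct \<open>r\<close>-sets span more than \<open>r\<close> vertices.\<close>

definition r_density :: "nat \<Rightarrow> 'a hgraph \<Rightarrow> real" where
  "r_density r F =
     Max {(real (card (edges F')) - 1) / (real (card (verts F')) - real r) | F'.
            subgraph F' F \<and> 2 \<le> card (edges F')}"

definition contains_copy :: "'b hgraph \<Rightarrow> 'a hgraph \<Rightarrow> bool" where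
  "contains_copy H F \<longleftrightarrow>
     (\<exists>f. inj_on f (verts F) \<and> f ` verts F \<subseteq> verts H \<and> (\<forall>e\<in>edges F. f ` e \<in> edges H))"

text \<open>\<open>turan_number r n F\<close> is \<open>ex(n, F)\<close>; the vertex set of an \<open>n\<close>-vertex \<open>r\<close>-graph is taken
  to be \<open>{..<n}\<close>. \<open>turan_in G F\<close> is \<open>ex(G, F)\<close>.\<close>

definition turan_number :: "nat \<Rightarrow> nat \<Rightarrow> 'a hgraph \<Rightarrow> nat" where
  "turan_number r n F =
     Max {card (edges H) | H :: nat hgraph.
            rgraph r H \<and> verts H = {..<n} \<and> \<not> contains_copy H F}"

definition turan_in :: "'b hgraph \<Rightarrow> 'a hgraph \<Rightarrow> nat" where
  "turan_in G F = Max {card (edges H) | H. subgraph H G \<and> \<not> contains_copy H F}"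

definition r_sets :: "nat \<Rightarrow> nat \<Rightarrow> nat set set" where
  "r_sets r n = {e. e \<subseteq> {..<n} \<and> card e = r}"

definition random_rgraph :: "nat \<Rightarrow> nat \<Rightarrow> real \<Rightarrow> nat hgraph pmf" where
  "random_rgraph r n p =
     map_pmf (\<lambda>X. ({..<n}, {e \<in> r_sets r n. X e}))
       (Pi_pmf (r_sets r n) False (\<lambda>_. bernoulli_pmf p))"

definition aas :: "nat \<Rightarrow> (nat \<Rightarrow> real) \<Rightarrow> (nat \<Rightarrow> nat hgraph \<Rightarrow> bool) \<Rightarrow> bool" where
  "aas r p A \<longleftrightarrow>
     (\<lambda>n. measure_pmf.prob (random_rgraph r n (p n)) {G. A n G}) \<longlonglongrightarrow> 1"

end

theory Submission
  imports Defs "HOL-Real_Asymp.Real_Asymp"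
begin

text \<open>Write \<open>\<alpha> = 1 / d\<close> for the reciprocal of the density \<open>d\<close> of \<open>F\<close>, and let \<open>F'\<close> be a subgraph, with
  \<open>v\<close> vertices and \<open>k \<ge> 2\<close> edges, that attains it, so \<open>v - r = (k - 1) \<alpha>\<close>. An \<open>F'\<close>-free graph is
  \<open>F\<close>-free.

  Sparse range. The number of edges of the random graph has mean \<open>\<mu> = p (n choose r)\<close> and variance
  at most \<open>\<mu>\<close>, so by Chebyshev it is concentrated, because \<open>n\<^sup>-\<^sup>r \<lless> p\<close> gives \<open>\<mu> \<rightarrow> \<infinity>\<close>. It is
  an upper bound for the extremal number. Deleting one edge from each copy of \<open>F'\<close> leaves an
  \<open>F\<close>-free graph, and the expected number of copies is at most \<open>n\<^sup>v p\<^sup>k\<close>, which relative to \<open>n\<^sup>r p\<close> is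
  \<open>(p / n powr (-\<alpha>)) ^ (k - 1) \<rightarrow> 0\<close>; so by Markov the deletion costs a vanishing fraction of the
  edges (\<open>prob_turan_in_concentrated\<close>, \<open>aas_turan_in_sparse\<close>).

  Dense range, second bound. The extremal number of \<open>G\<close> is monotone in \<open>G\<close>, hence stochastically
  monotone in \<open>p\<close>. So \<open>p\<close> may be lowered to \<open>q = n powr (-\<alpha>) / sqrt (ln n)\<close>, where the first part
  gives about \<open>q (n choose r)\<close> edges. This exceeds \<open>n powr (r - \<alpha>) / ln n\<close> by a factor of order
  \<open>sqrt (ln n)\<close>, which absorbs all constants (\<open>aas_turan_in_dense\<close>).

  Dense range, first bound. Intersecting the random graph with a fixed extremal \<open>F\<close>-free graph keeps
  at least half of the expected \<open>p ex(n, F)\<close> edges, by Chebyshev, provided that \<open>p ex(n, F) \<rightarrow> \<infinity>\<close>.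
  This can fail; but if half of \<open>p ex(n, F)\<close> is at most \<open>n powr (r - \<alpha>) / ln n\<close>, the second
  bound already implies the first with constant one half. Otherwise \<open>p ex(n, F)\<close> is at least of order
  \<open>n / ln n\<close>, because \<open>\<alpha> \<le> r - 1\<close>: two edges of \<open>F\<close> that share a vertex span at most
  \<open>2 r - 1\<close> vertices, so already they have density at least \<open>1 / (r - 1)\<close>.\<close>

section \<open>Random subsets of a finite set\<close>

text \<open>Forgetting the vertex set \<open>{..<n}\<close>, the random graph is a random subset of the
  \<open>r\<close>-sets. The moment estimates and the monotonicity in \<open>p\<close> hold for random subsets of any
  finite set.\<close>

definition random_subset :: "'a set \<Rightarrow> real \<Rightarrow> 'a set pmf" where
  "random_subset A p = map_pmf (\<lambda>X. {e \<in> A. X e}) (Pi_pmf A False (\<lambda>_. bernoulli_pmf p))"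

lemma random_rgraph_eq_random_subset:
  "random_rgraph r n p = map_pmf (Pair {..<n}) (random_subset (r_sets r n) p)"
  by (simp add: random_rgraph_def random_subset_def pmf.map_comp o_def)

lemma set_random_subset: "set_pmf (random_subset A p) \<subseteq> Pow A"
  by (auto simp: random_subset_def)

lemma integrable_random_subset:
  fixes f :: "'a set \<Rightarrow> real"
  assumes "finite A"
  shows "integrable (measure_pmf (random_subset A p)) f"
  using assms finite_subset[OF set_random_subset]
  by (intro integrable_measure_pmf_finite) auto

lemma prob_random_subset_superset:
  assumes "finite A" "S \<subseteq> A" "0 \<le> p" "p \<le> 1"
  shows "measure_pmf.prob (random_subset A p) {T. S \<subseteq> T} = p ^ card S"
proof -
  have "measure_pmf.prob (random_subset A p) {T. S \<subseteq> T} =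
      measure_pmf.prob (Pi_pmf A False (\<lambda>_. bernoulli_pmf p)) (Pi A (\<lambda>e. if e \<in> S then {True} else UNIV))"
    unfolding random_subset_def measure_map_pmf
    using assms(2) by (intro arg_cong[where f = "measure_pmf.prob _"])
      (auto simp: Pi_def vimage_def subset_iff split: if_splits)
  also have "\<dots> = (\<Prod>e\<in>A. if e \<in> S then p else 1)"
    unfolding measure_Pi_pmf_Pi[OF assms(1)]
    using assms by (intro prod.cong) (auto simp: measure_pmf_single)
  also have "\<dots> = p ^ card S"
    using assms by (simp add: prod.If_cases Int_absorb1)
  finally show ?thesis .
qed

text \<open>With singletons as the sets \<open>S i\<close> this is the expected size of the random subset, with the
  sets \<open>{e, f}\<close> its second moment, and with the edge sets of the copies of a graph the
  expected number of copies that appear.\<close>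

lemma expectation_card_captured:
  assumes "finite A" "0 \<le> p" "p \<le> 1" "finite I" "\<And>i. i \<in> I \<Longrightarrow> S i \<subseteq> A"
  shows "measure_pmf.expectation (random_subset A p) (\<lambda>T. real (card {i \<in> I. S i \<subseteq> T})) =
    (\<Sum>i\<in>I. p ^ card (S i))"
proof -
  have "real (card {i \<in> I. S i \<subseteq> T}) = (\<Sum>i\<in>I. indicator {T. S i \<subseteq> T} T)" for T
    using assms(4) by (simp add: indicator_def sum.If_cases Int_def)
  then have "measure_pmf.expectation (random_subset A p) (\<lambda>T. real (card {i \<in> I. S i \<subseteq> T})) =
      (\<Sum>i\<in>I. measure_pmf.expectation (random_subset A p) (indicator {T. S i \<subseteq> T}))"
    using integrable_random_subset[OF assms(1)] by (simp add: Bochner_Integration.integral_sum)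
  also have "\<dots> = (\<Sum>i\<in>I. p ^ card (S i))"
    using assms by (intro sum.cong) (auto simp: prob_random_subset_superset)
  finally show ?thesis .
qed

lemma prob_many_captured_le:
  assumes "finite A" "0 \<le> p" "p \<le> 1" "finite I" "\<And>i. i \<in> I \<Longrightarrow> S i \<subseteq> A" "c > 0"
  shows "measure_pmf.prob (random_subset A p) {T. c \<le> real (card {i \<in> I. S i \<subseteq> T})} \<le>
    (\<Sum>i\<in>I. p ^ card (S i)) / c"
  using integral_Markov_inequality_measure[of "measure_pmf (random_subset A p)"
      "\<lambda>T. real (card {i \<in> I. S i \<subseteq> T})" "{}" c] assms integrable_random_subset[OF assms(1)]
    expectation_card_captured[OF assms(1-5)]
  by simp

text \<open>Chebyshev's inequality. The second moment counts ordered pairs; the pairs of distinct elements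
  contribute at most the square of the mean, and the diagonal the mean itself, which bounds
  the variance.\<close>

lemma prob_card_deviates_le:
  assumes "finite A" "B \<subseteq> A" "0 \<le> p" "p \<le> 1" "a > 0"
  shows "measure_pmf.prob (random_subset A p) {T. a \<le> \<bar>real (card (T \<inter> B)) - p * real (card B)\<bar>} \<le>
    p * real (card B) / a\<^sup>2"
proof -
  let ?M = "random_subset A p" and ?X = "\<lambda>T. real (card (T \<inter> B))"
  have fB: "finite B" using assms finite_subset by auto
  note int = integrable_random_subset[OF assms(1)]
  have 1: "measure_pmf.expectation ?M ?X = p * real (card B)"
    using expectation_card_captured[OF assms(1,3,4) fB, of "\<lambda>e. {e}"] subsetD[OF assms(2)]
    by (simp add: Int_def conj_commute mult.commute)
  \<comment> \<open>The square counts the ordered pairs inside \<open>T\<close>, a sum to which the first moment formula applies.\<close>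
  have sq: "(?X T)\<^sup>2 = real (card {x \<in> B \<times> B. {fst x, snd x} \<subseteq> T})" for T
  proof -
    have "{x \<in> B \<times> B. {fst x, snd x} \<subseteq> T} = (T \<inter> B) \<times> (T \<inter> B)" by auto
    then show ?thesis by (simp add: card_cartesian_product power2_eq_square)
  qed
  have "measure_pmf.expectation ?M (\<lambda>T. (?X T)\<^sup>2) = (\<Sum>x\<in>B \<times> B. p ^ card {fst x, snd x})"
    using expectation_card_captured[OF assms(1,3,4), of "B \<times> B" "\<lambda>x. {fst x, snd x}"] assms(2) fB
    unfolding sq by fastforce
  also have "\<dots> \<le> (\<Sum>x\<in>B \<times> B. p\<^sup>2 + (if snd x = fst x then p else 0))"
    using assms by (intro sum_mono) (auto simp: card_insert_if power2_eq_square)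
  also have "\<dots> = (\<Sum>e\<in>B. \<Sum>f\<in>B. p\<^sup>2 + (if f = e then p else 0))"
    by (subst sum.cartesian_product) (simp add: case_prod_beta)
  also have "\<dots> = (p * real (card B))\<^sup>2 + p * real (card B)"
    using fB by (simp add: sum.distrib power2_eq_square algebra_simps)
  finally have "measure_pmf.variance ?M ?X \<le> p * real (card B)"
    by (subst measure_pmf.variance_eq) (auto simp: int 1)
  moreover have "measure_pmf.prob ?M {T. a \<le> \<bar>?X T - p * real (card B)\<bar>} \<le>
      measure_pmf.variance ?M ?X / a\<^sup>2"
    using measure_pmf.Chebyshev_inequality[of ?X ?M a] assms(5) by (simp add: int 1)
  ultimately show ?thesis
    using assms(5) by (meson divide_right_mono order_trans zero_le_power2)
qed

text \<open>Thinning couples the two random subsets: a coin of bias \<open>q\<close> is a coin of bias \<open>p\<close> followed, on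
  success, by one of bias \<open>q / p\<close>. So the \<open>q\<close>-random subset arises by deleting elements from the
  \<open>p\<close>-random one, and if it lies in the up-closed family \<open>U\<close>, so does the latter.\<close>

lemma prob_random_subset_mono:
  assumes "finite A" "0 \<le> q" "q \<le> p" "p \<le> 1"
    and up: "\<And>S T. S \<in> U \<Longrightarrow> S \<subseteq> T \<Longrightarrow> T \<subseteq> A \<Longrightarrow> T \<in> U"
  shows "measure_pmf.prob (random_subset A q) U \<le> measure_pmf.prob (random_subset A p) U"
proof (cases "p = 0")
  case False
  then have p: "p > 0" using assms by auto
  define k where "k = (\<lambda>b. if b then bernoulli_pmf (q / p) else return_pmf False)"
  have k: "bernoulli_pmf q = bind_pmf (bernoulli_pmf p) k"
  proof (rule pmf_eqI)
    fix b show "pmf (bernoulli_pmf q) b = pmf (bind_pmf (bernoulli_pmf p) k) b"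
      using assms p by (cases b) (auto simp: pmf_bind k_def integral_bernoulli_pmf divide_simps)
  qed
  let ?P = "Pi_pmf A False (\<lambda>_. bernoulli_pmf p)"
  let ?K = "\<lambda>f. Pi_pmf A False (\<lambda>x. k (f x))"
  let ?V = "{X. {e \<in> A. X e} \<in> U}"
  have fin: "finite (set_pmf ?P)"
    using finite_subset[OF set_Pi_pmf_subset'[OF assms(1)]] assms(1)
    by (meson finite finite_PiE_dflt)
  \<comment> \<open>Thinning only removes elements, so a set outside of \<open>U\<close> cannot be thinned to one inside.\<close>
  have sub: "measure_pmf.prob (?K f) ?V \<le> indicator ?V f" for f
  proof (cases "f \<in> ?V")
    case False
    have "X \<notin> ?V" if "X \<in> set_pmf (?K f)" for X
    proof -
      have "X x \<in> set_pmf (k (f x))" if "x \<in> A" for x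
        using \<open>X \<in> _\<close> that assms(1) by (auto simp: set_Pi_pmf PiE_dflt_def)
      then have "{e \<in> A. X e} \<subseteq> {e \<in> A. f e}"
        by (fastforce simp: k_def split: if_splits)
      with False up show ?thesis by blast
    qed
    then have "measure_pmf.prob (?K f) ?V = 0"
      by (subst measure_pmf_zero_iff) auto
    then show ?thesis by simp
  qed simp
  have "measure_pmf.prob (random_subset A q) U = measure_pmf.prob (bind_pmf ?P ?K) ?V"
    unfolding random_subset_def measure_map_pmf k
    by (subst Pi_pmf_bind[OF assms(1), where d' = False]) (simp add: vimage_def)
  also have "\<dots> = measure_pmf.expectation ?P (\<lambda>f. measure_pmf.prob (?K f) ?V)"
    unfolding measure_pmf_bind
    by (rule measure_pmf.measure_bind[where N = "count_space UNIV"])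
      (auto simp: space_subprob_algebra intro!: measure_pmf.subprob_space_axioms)
  also have "\<dots> \<le> measure_pmf.expectation ?P (indicator ?V)"
    using fin by (intro integral_mono integrable_measure_pmf_finite sub) auto
  also have "\<dots> = measure_pmf.prob (random_subset A p) U"
    by (simp add: random_subset_def vimage_def)
  finally show ?thesis .
qed (use assms in auto)

section \<open>Extremal numbers and deletion of edges\<close>

lemma finite_r_sets: "finite (r_sets r n)"
  by (simp add: r_sets_def)

lemma card_r_sets: "card (r_sets r n) = n choose r"
  by (simp add: r_sets_def n_subsets)

lemma edges_nonempty_not_contains_copy:
  assumes "edges F \<noteq> {}"
  shows "\<not> contains_copy (V, {}) F"
  using assms by (auto simp: contains_copy_def)

lemma contains_copy_subgraph:
  assumes "contains_copy H F" "subgraph F' F"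
  shows "contains_copy H F'"
proof -
  obtain f where "inj_on f (verts F)" "f ` verts F \<subseteq> verts H" "\<forall>e\<in>edges F. f ` e \<in> edges H"
    using assms(1) unfolding contains_copy_def by blast
  then show ?thesis
    using assms(2) unfolding contains_copy_def subgraph_def
    by (intro exI[of _ f]) (auto intro: inj_on_subset)
qed

lemma finite_subgraph_sizes:
  assumes "finite (edges G)"
  shows "finite {card (edges H) | H. subgraph H G \<and> \<not> contains_copy H F}"
  by (rule finite_subset[of _ "{..card (edges G)}"])
    (auto simp: subgraph_def intro: card_mono[OF assms])

lemma card_le_turan_in:
  assumes "finite (edges G)" "subgraph H G" "\<not> contains_copy H F"
  shows "card (edges H) \<le> turan_in G F"
  unfolding turan_in_def using assms(2,3)
  by (intro Max_ge finite_subgraph_sizes[OF assms(1)]) blast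

lemma turan_in_attained:
  assumes "finite (edges G)" "edges F \<noteq> {}"
  obtains H where "subgraph H G" "\<not> contains_copy H F" "card (edges H) = turan_in G F"
proof -
  have "subgraph ({}, {}) G" by (simp add: subgraph_def)
  then have "turan_in G F \<in> {card (edges H) | H. subgraph H G \<and> \<not> contains_copy H F}"
    unfolding turan_in_def using edges_nonempty_not_contains_copy[OF assms(2), of "{}"]
    by (intro Max_in finite_subgraph_sizes assms) auto
  then show ?thesis using that by auto
qed

lemma turan_in_le_card:
  assumes "finite (edges G)" "edges F \<noteq> {}"
  shows "turan_in G F \<le> card (edges G)"
proof -
  obtain H where "subgraph H G" "card (edges H) = turan_in G F"
    using turan_in_attained[OF assms] by metis
  then show ?thesis
    using card_mono[OF assms(1), of "edges H"] by (simp add: subgraph_def)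
qed

lemma turan_in_mono:
  assumes "finite (edges G')" "edges F \<noteq> {}" "verts G \<subseteq> verts G'" "edges G \<subseteq> edges G'"
  shows "turan_in G F \<le> turan_in G' F"
proof -
  obtain H where "subgraph H G" "\<not> contains_copy H F" "card (edges H) = turan_in G F"
    using turan_in_attained[of G F] assms finite_subset by metis
  then show ?thesis
    using card_le_turan_in[of G' H F] assms by (auto simp: subgraph_def)
qed

lemma turan_number_attained:
  assumes "edges F \<noteq> {}"
  obtains E where "E \<subseteq> r_sets r n" "\<not> contains_copy ({..<n}, E) F" "card E = turan_number r n F"
proof -
  let ?S = "{card (edges H) | H :: nat hgraph.
    rgraph r H \<and> verts H = {..<n} \<and> \<not> contains_copy H F}"
  have sub: "edges H \<subseteq> r_sets r n" if "rgraph r H" "verts H = {..<n}" for H :: "nat hgraph"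
    using that by (auto simp: rgraph_def r_sets_def)
  have "finite ?S"
    by (rule finite_subset[of _ "{..card (r_sets r n)}"])
      (use card_mono[OF finite_r_sets sub] in auto)
  moreover have "rgraph r ({..<n}, {})" by (simp add: rgraph_def)
  then have "?S \<noteq> {}" using edges_nonempty_not_contains_copy[OF assms, of "{..<n}"] by fastforce
  ultimately have "turan_number r n F \<in> ?S"
    unfolding turan_number_def by (rule Max_in)
  then obtain H :: "nat hgraph" where "rgraph r H" "verts H = {..<n}" "\<not> contains_copy H F"
    "card (edges H) = turan_number r n F" by auto
  then show ?thesis
    using that[of "edges H"] sub by (metis prod.collapse)
qed

text \<open>Extensional functions, so that each way of placing \<open>V\<close> inside \<open>W\<close> is one function and a finite
  set has finitely many of them.\<close>

definition embeddings :: "'a set \<Rightarrow> 'b set \<Rightarrow> ('a \<Rightarrow> 'b) set" where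
  "embeddings V W = {f \<in> V \<rightarrow>\<^sub>E W. inj_on f V}"

lemma finite_embeddings: "finite V \<Longrightarrow> finite W \<Longrightarrow> finite (embeddings V W)"
  by (simp add: embeddings_def finite_PiE)

lemma card_embeddings_le:
  assumes "finite V" "finite W"
  shows "card (embeddings V W) \<le> card W ^ card V"
proof -
  have "card (embeddings V W) \<le> card (V \<rightarrow>\<^sub>E W)"
    unfolding embeddings_def using assms by (intro card_mono finite_PiE) auto
  then show ?thesis using assms by (simp add: card_PiE)
qed

text \<open>The deletion argument: removing one fixed edge from every embedded copy of \<open>F'\<close> destroys all
  copies of \<open>F'\<close>, hence of \<open>F\<close>, and costs at most one edge for each embedding.\<close>

lemma card_le_turan_in_plus_copies:
  assumes "finite V" "finite T" "\<And>e. e \<in> T \<Longrightarrow> e \<subseteq> V"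
    and F': "finite (verts F')" "subgraph F' F" "edges F' \<noteq> {}"
  shows "card T \<le> turan_in (V, T) F +
    card {f \<in> embeddings (verts F') V. (`) f ` edges F' \<subseteq> T}"
proof -
  let ?B = "{f \<in> embeddings (verts F') V. (`) f ` edges F' \<subseteq> T}"
  obtain e0 where e0: "e0 \<in> edges F'" using F'(3) by auto
  define R where "R = (\<lambda>f. f ` e0) ` ?B"
  have finB: "finite ?B" using finite_embeddings[OF F'(1) assms(1)] by simp
  have "\<not> contains_copy (V, T - R) F'"
  proof
    assume "contains_copy (V, T - R) F'"
    then obtain f where f: "inj_on f (verts F')" "f ` verts F' \<subseteq> V" "\<forall>e\<in>edges F'. f ` e \<in> T - R"
      unfolding contains_copy_def by auto
    define g where "g = restrict f (verts F')"
    have g: "g ` e = f ` e" if "e \<in> edges F'" for e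
      using that F'(2) by (intro image_cong) (auto simp: g_def subgraph_def)
    have "inj_on g (verts F')" using f(1) by (simp add: g_def inj_on_def)
    with f(2,3) have "g \<in> ?B" using g by (auto simp: embeddings_def g_def)
    then have "g ` e0 \<in> R" unfolding R_def by blast
    with f(3) g e0 show False by auto
  qed
  then have "\<not> contains_copy (V, T - R) F"
    using contains_copy_subgraph F'(2) by blast
  moreover have "subgraph (V, T - R) (V, T)"
    using assms(3) by (auto simp: subgraph_def)
  ultimately have "card (T - R) \<le> turan_in (V, T) F"
    using card_le_turan_in[of "(V, T)" "(V, T - R)" F] assms(2) by simp
  moreover have "card R \<le> card ?B" unfolding R_def by (rule card_image_le[OF finB])
  moreover have "card T - card R \<le> card (T - R)"
    using finB by (intro diff_card_le_card_Diff) (simp add: R_def)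
  ultimately show ?thesis by linarith
qed

section \<open>The density\<close>

lemma max_degree_ge_2E:
  assumes "rgraph r F" "max_degree F \<ge> 2"
  obtains e f v where "e \<in> edges F" "f \<in> edges F" "e \<noteq> f" "v \<in> e" "v \<in> f"
proof -
  have "max_degree F \<in> insert 0 (vertex_degree F ` verts F)"
    unfolding max_degree_def using assms(1) by (intro Max_in) (auto simp: rgraph_def)
  then obtain v where "2 \<le> card {e \<in> edges F. v \<in> e}"
    using assms(2) by (auto simp: vertex_degree_def)
  then obtain S where S: "S \<subseteq> {e \<in> edges F. v \<in> e}" "card S = 2"
    by (meson obtain_subset_with_card_n)
  then obtain e f where "S = {e, f}" "e \<noteq> f" by (meson card_2_iff)
  with S(1) show ?thesis by (intro that[of e f v]) auto
qed

text \<open>Two edges \<open>e\<close> and \<open>f\<close> with a common vertex form a subgraph on more than \<open>r\<close> and at most \<open>2 r - 1\<close>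
  vertices. Its density bounds that of \<open>F\<close> from below by \<open>1 / (r - 1)\<close>; in particular the
  density is positive, so the quotient for a maximising \<open>F'\<close> has a nonzero denominator and
  can be solved for \<open>v(F') - r\<close>.\<close>

lemma r_density_properties:
  assumes F: "rgraph r F" and deg: "max_degree F \<ge> 2"
  obtains F' where "subgraph F' F" "2 \<le> card (edges F')"
    and "real (card (verts F')) - real r = (real (card (edges F')) - 1) * (1 / r_density r F)"
    and "r_density r F > 0" "1 / r_density r F \<le> real r - 1"
proof -
  let ?D = "\<lambda>F'. (real (card (edges F')) - 1) / (real (card (verts F')) - real r)"
  let ?P = "\<lambda>F'. subgraph F' F \<and> 2 \<le> card (edges F')"
  let ?S = "{?D F' | F'. ?P F'}"
  have finV: "finite (verts F)" using F by (simp add: rgraph_def)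
  have "edges F \<subseteq> Pow (verts F)" using F by (auto simp: rgraph_def)
  then have "{F'. ?P F'} \<subseteq> Pow (verts F) \<times> Pow (Pow (verts F))"
    unfolding subgraph_def by fastforce
  then have "finite {F'. ?P F'}" using finV by (meson finite_Pow_iff finite_SigmaI finite_subset)
  moreover have S: "?S = ?D ` {F'. ?P F'}" by blast
  ultimately have fin: "finite ?S" by simp
  obtain e f v where ef: "e \<in> edges F" "f \<in> edges F" "e \<noteq> f" "v \<in> e" "v \<in> f"
    using max_degree_ge_2E[OF F deg] .
  then have c: "card e = r" "card f = r" "finite e" "finite f"
    using F finite_subset[OF _ finV] by (auto simp: rgraph_def)
  have "?P (e \<union> f, {e, f})"
    using ef F by (auto simp: subgraph_def rgraph_def)
  then have in_S: "?D (e \<union> f, {e, f}) \<in> ?S" by blast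
  have D: "?D (e \<union> f, {e, f}) = 1 / (real (card (e \<union> f)) - real r)" using ef by simp
  have "e \<subset> e \<union> f" using c ef(3) card_subset_eq[of e f] by auto
  then have lower: "r < card (e \<union> f)" using psubset_card_mono[of "e \<union> f" e] c by simp
  have "card (e \<inter> f) > 0" using ef c by (auto simp: card_gt_0_iff)
  then have upper: "card (e \<union> f) + 1 \<le> 2 * r" using card_Un_Int[OF c(3,4)] c by linarith
  have "1 / (real (card (e \<union> f)) - real r) \<le> r_density r F"
    unfolding r_density_def D[symmetric] using Max_ge[OF fin in_S] .
  moreover have "1 / (real r - 1) \<le> 1 / (real (card (e \<union> f)) - real r)"
    using lower upper by (intro divide_left_mono mult_pos_pos) auto
  ultimately have ge: "1 / (real r - 1) \<le> r_density r F" by simp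
  have r: "real r - 1 > 0" using lower upper by linarith
  with ge have pos: "r_density r F > 0" by (smt (verit) divide_pos_pos)
  have "r_density r F \<in> ?S"
    unfolding r_density_def using in_S by (intro Max_in fin) blast
  then obtain F' where F': "?P F'" "r_density r F = ?D F'" by auto
  with pos have "real (card (verts F')) - real r \<noteq> 0" by auto
  moreover have "real (card (edges F')) - 1 \<noteq> 0" using F'(1) by auto
  ultimately have "real (card (verts F')) - real r = (real (card (edges F')) - 1) * (1 / r_density r F)"
    unfolding F'(2) by simp
  moreover have "1 / r_density r F \<le> real r - 1"
    using ge pos r by (simp add: field_simps)
  ultimately show ?thesis using that F' pos by blast
qed

section \<open>The sparse range\<close>

text \<open>A bound for fixed \<open>n\<close> and \<open>p\<close>. Two bad events are excluded: the number of edges deviates from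
  \<open>\<mu>\<close> by \<open>t \<mu>\<close>, or there are at least \<open>t \<mu>\<close> copies of \<open>F'\<close>. Chebyshev and Markov bound their
  probabilities by \<open>(1 / \<mu>) / t\<^sup>2\<close> and \<open>(n\<^sup>v p\<^sup>k / \<mu>) / t\<close>. The cube in the hypothesis is what makes
  both small, at most \<open>t\<close> and \<open>t\<^sup>2\<close>.\<close>

lemma prob_turan_in_concentrated:
  fixes F :: "'a hgraph" and \<mu> t :: real
  assumes F: "rgraph r F" and F': "subgraph F' F" "edges F' \<noteq> {}"
    and p: "0 \<le> p" "p \<le> 1" and t: "t > 0"
    and \<mu>: "\<mu> = p * real (n choose r)" "\<mu> > 0"
    and small: "1 / \<mu> + real n ^ card (verts F') * p ^ card (edges F') / \<mu> \<le> t ^ 3"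
  shows "1 - (t + t\<^sup>2) \<le> measure_pmf.prob (random_rgraph r n p)
    {G. \<bar>real (turan_in G F) - \<mu>\<bar> \<le> 2 * t * \<mu>}"
proof -
  let ?A = "r_sets r n" and ?M = "random_subset (r_sets r n) p"
  let ?v = "card (verts F')" and ?k = "card (edges F')"
  let ?good = "{T. \<bar>real (turan_in ({..<n}, T) F) - \<mu>\<bar> \<le> 2 * t * \<mu>}"
  let ?I = "embeddings (verts F') {..<n}" and ?S = "\<lambda>f. (`) f ` edges F'"
  let ?dev = "{T. t * \<mu> \<le> \<bar>real (card (T \<inter> ?A)) - p * real (card ?A)\<bar>}"
  let ?many = "{T. t * \<mu> \<le> real (card {f \<in> ?I. ?S f \<subseteq> T})}"
  have finV: "finite (verts F')"
    using F F'(1) finite_subset by (auto simp: rgraph_def subgraph_def)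
  have finI: "finite ?I" using finV by (simp add: finite_embeddings)
  have edge: "e \<subseteq> verts F'" "card e = r" if "e \<in> edges F'" for e
    using that F F'(1) by (auto simp: rgraph_def subgraph_def)
  have S: "?S f \<subseteq> ?A" "card (?S f) = ?k" if "f \<in> ?I" for f
  proof -
    have f: "inj_on f (verts F')" "f ` verts F' \<subseteq> {..<n}"
      using that by (auto simp: embeddings_def)
    show "?S f \<subseteq> ?A"
      using image_mono[OF edge(1), of _ f] edge f
      by (fastforce simp: r_sets_def card_image inj_on_subset)
    have "inj_on f (\<Union> (edges F'))" by (rule inj_on_subset[OF f(1)]) (use edge in auto)
    then show "card (?S f) = ?k" by (intro card_image inj_on_image)
  qed
  have tm: "t * \<mu> > 0" using t \<mu> by simp
  have "measure_pmf.prob ?M ?dev \<le> \<mu> / (t * \<mu>)\<^sup>2"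
    using prob_card_deviates_le[OF finite_r_sets subset_refl p tm, of r n]
    by (simp add: card_r_sets \<mu>(1))
  also have "\<dots> = (1 / \<mu>) / t\<^sup>2" using \<mu>(2) by (simp add: power2_eq_square)
  also have "\<dots> \<le> t ^ 3 / t\<^sup>2"
  proof (intro divide_right_mono)
    have "0 \<le> real n ^ ?v * p ^ ?k / \<mu>" using p \<mu>(2) by simp
    then show "1 / \<mu> \<le> t ^ 3" using small by linarith
  qed simp
  also have "\<dots> = t" using t by (simp add: power2_eq_square power3_eq_cube)
  finally have dev: "measure_pmf.prob ?M ?dev \<le> t" .
  have "measure_pmf.prob ?M ?many \<le> (\<Sum>f\<in>?I. p ^ card (?S f)) / (t * \<mu>)"
    by (rule prob_many_captured_le) (use finite_r_sets p finI S tm in auto)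
  also have "(\<Sum>f\<in>?I. p ^ card (?S f)) = real (card ?I) * p ^ ?k"
    using S by simp
  also have "\<dots> / (t * \<mu>) \<le> real n ^ ?v * p ^ ?k / (t * \<mu>)"
  proof (intro divide_right_mono mult_right_mono)
    show "real (card ?I) \<le> real n ^ ?v"
      using card_embeddings_le[OF finV, of "{..<n}"] by (metis card_lessThan finite_lessThan of_nat_le_iff of_nat_power)
  qed (use p tm in auto)
  also have "\<dots> = (real n ^ ?v * p ^ ?k / \<mu>) / t" by simp
  also have "\<dots> \<le> t ^ 3 / t"
  proof (intro divide_right_mono)
    have "0 \<le> 1 / \<mu>" using \<mu>(2) by simp
    then show "real n ^ ?v * p ^ ?k / \<mu> \<le> t ^ 3" using small by linarith
  qed (use t in simp)
  also have "\<dots> = t\<^sup>2" using t by (simp add: power2_eq_square power3_eq_cube)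
  finally have many: "measure_pmf.prob ?M ?many \<le> t\<^sup>2" .
  have "T \<in> ?good" if T: "T \<in> set_pmf ?M" "T \<notin> ?dev" "T \<notin> ?many" for T
  proof -
    have TA: "T \<subseteq> ?A" using T(1) set_random_subset by auto
    then have finT: "finite T" using finite_subset[OF _ finite_r_sets] by blast
    have F_ne: "edges F \<noteq> {}" using F' by (auto simp: subgraph_def)
    have "real (turan_in ({..<n}, T) F) \<le> real (card T)"
      using turan_in_le_card[of "({..<n}, T)" F] finT F_ne by simp
    moreover have "card T \<le> turan_in ({..<n}, T) F + card {f \<in> ?I. ?S f \<subseteq> T}"
      using TA finT finV F' by (intro card_le_turan_in_plus_copies) (auto simp: r_sets_def)
    then have "real (card T) \<le> real (turan_in ({..<n}, T) F) + real (card {f \<in> ?I. ?S f \<subseteq> T})"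
      by linarith
    moreover have "\<bar>real (card T) - \<mu>\<bar> < t * \<mu>"
      using T(2) TA by (simp add: \<mu>(1) card_r_sets Int_absorb2)
    moreover have "real (card {f \<in> ?I. ?S f \<subseteq> T}) < t * \<mu>" using T(3) by simp
    ultimately have "\<bar>real (turan_in ({..<n}, T) F) - \<mu>\<bar> \<le> 2 * (t * \<mu>)" by linarith
    then show ?thesis by (simp add: mult.assoc)
  qed
  then have "measure_pmf.prob ?M (- ?good) \<le> measure_pmf.prob ?M (?dev \<union> ?many)"
    by (intro measure_pmf.finite_measure_mono_AE) (auto simp: AE_measure_pmf_iff)
  also have "\<dots> \<le> measure_pmf.prob ?M ?dev + measure_pmf.prob ?M ?many"
    by (rule measure_Un_le) auto
  finally have "measure_pmf.prob ?M (- ?good) \<le> t + t\<^sup>2" using dev many by linarith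
  then have "1 - (t + t\<^sup>2) \<le> measure_pmf.prob ?M ?good"
    using measure_pmf.prob_compl[of ?good ?M] by (simp add: Compl_eq_Diff_UNIV)
  then show ?thesis
    by (simp add: random_rgraph_eq_random_subset vimage_def)
qed

lemma aasI:
  assumes "eventually (\<lambda>n. g n \<le> measure_pmf.prob (random_rgraph r n (p n)) {G. A n G}) sequentially"
    and "g \<longlonglongrightarrow> 1"
  shows "aas r p A"
  unfolding aas_def
  by (rule tendsto_sandwich[OF assms(1) _ assms(2) tendsto_const]) simp

lemma binomial_lower_bound:
  assumes "r \<le> n"
  shows "real n ^ r / real r ^ r \<le> real (n choose r)"
  using binomial_ge_n_over_k_pow_k[OF assms, where 'a = real] by (simp add: power_divide)

text \<open>The bound for fixed \<open>n\<close> is used with \<open>t\<close> the cube root of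
  \<open>1 / \<mu> + n\<^sup>v p\<^sup>k / \<mu>\<close>. Since \<open>\<mu>\<close> has order \<open>p n\<^sup>r\<close>, the lower bound on \<open>p\<close> sends the first summand to
  zero; by the choice of \<open>F'\<close> the second has order \<open>(p / n powr (-1 / d)) ^ (k - 1)\<close>, and the upper
  bound on \<open>p\<close> sends it to zero.\<close>

lemma aas_turan_in_sparse:
  fixes F :: "'a hgraph" and p :: "nat \<Rightarrow> real"
  assumes F: "rgraph r F" and deg: "max_degree F \<ge> 2"
    and p: "\<And>n. 0 \<le> p n \<and> p n \<le> 1"
    and lower: "(\<lambda>n. real n powr (- real r)) \<in> o(p)"
    and upper: "p \<in> o(\<lambda>n. real n powr (- 1 / r_density r F))"
  shows "\<exists>\<delta> :: nat \<Rightarrow> real. \<delta> \<longlonglongrightarrow> 0 \<and>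
    aas r p (\<lambda>n G. \<exists>\<eta>. \<bar>\<eta>\<bar> \<le> \<delta> n \<and>
      real (turan_in G F) = (1 + \<eta>) * (p n * real (n choose r)))"
proof -
  obtain F' where F': "subgraph F' F" "2 \<le> card (edges F')"
    and dens: "real (card (verts F')) - real r = (real (card (edges F')) - 1) * (1 / r_density r F)"
    and "1 / r_density r F \<le> real r - 1" "r_density r F > 0"
    using r_density_properties[OF F deg] .
  then have r: "r > 0" by (smt (verit) divide_pos_pos gr0I of_nat_0)
  have F'_ne: "edges F' \<noteq> {}" using F'(2) by auto
  define v where "v = card (verts F')"
  obtain m where m: "card (edges F') = Suc m" "m > 0" using F'(2) by (cases "card (edges F')") auto
  define \<mu> where "\<mu> n = p n * real (n choose r)" for n
  define w where "w n = 1 / \<mu> n + real n ^ v * p n ^ Suc m / \<mu> n" for n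
  define t where "t n = root 3 (w n)" for n
  have ev_p: "eventually (\<lambda>n. p n > 0) sequentially"
    using landau_o.smallD[OF lower zero_less_one] eventually_gt_at_top[of 0]
  proof eventually_elim
    case (elim n)
    then have "0 < \<bar>p n\<bar>" by (smt (verit) of_nat_0_less_iff powr_gt_zero real_norm_def)
    then show ?case using p[of n] by simp
  qed
  then have ev_\<mu>: "eventually (\<lambda>n. \<mu> n > 0) sequentially"
    using eventually_ge_at_top[of r] by eventually_elim (simp add: \<mu>_def)
  have lim: "(\<lambda>n. real r ^ r * (real n powr (- real r) / p n) +
      real r ^ r * (p n / real n powr (- 1 / r_density r F)) ^ m) \<longlonglongrightarrow> real r ^ r * 0 + real r ^ r * 0 ^ m"
    by (intro tendsto_intros smalloD_tendsto[OF lower] smalloD_tendsto[OF upper])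
  have w_le: "eventually (\<lambda>n. w n \<le> real r ^ r * (real n powr (- real r) / p n) +
      real r ^ r * (p n / real n powr (- 1 / r_density r F)) ^ m) sequentially"
    using ev_p eventually_ge_at_top[of r] eventually_gt_at_top[of 0]
  proof eventually_elim
    case (elim n)
    have "p n * (real n ^ r / real r ^ r) \<le> \<mu> n"
      unfolding \<mu>_def using elim binomial_lower_bound[of r n] by (intro mult_left_mono) auto
    moreover have pos: "p n * (real n ^ r / real r ^ r) > 0" using elim r by simp
    ultimately have "x / \<mu> n \<le> x / (p n * (real n ^ r / real r ^ r))" if "x \<ge> 0" for x
      using that pos by (intro frac_le) auto
    from this[of 1] this[of "real n ^ v * p n ^ Suc m"] have
      "w n \<le> 1 / (p n * (real n ^ r / real r ^ r)) +
        real n ^ v * p n ^ Suc m / (p n * (real n ^ r / real r ^ r))"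
      unfolding w_def using elim by simp
    also have "1 / (p n * (real n ^ r / real r ^ r)) = real r ^ r * (real n powr (- real r) / p n)"
      using elim by (simp add: powr_minus powr_realpow divide_simps)
    also have "real n ^ v * p n ^ Suc m / (p n * (real n ^ r / real r ^ r)) =
        real r ^ r * (real n powr (real v - real r) * p n ^ m)"
      using elim by (simp add: powr_diff powr_realpow divide_simps)
    also have "real n powr (real v - real r) = (real n powr (1 / r_density r F)) ^ m"
      unfolding v_def dens m(1) using elim by (simp add: powr_powr flip: powr_realpow)
    also have "\<dots> * p n ^ m = (p n / real n powr (- 1 / r_density r F)) ^ m"
      by (simp add: powr_minus divide_inverse mult.commute flip: power_mult_distrib)
    finally show ?case .
  qed
  have w_pos: "eventually (\<lambda>n. w n > 0) sequentially"
    using ev_\<mu> by eventually_elim (use p in \<open>auto simp: w_def intro!: add_pos_nonneg\<close>)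
  have "w \<longlonglongrightarrow> 0"
    by (rule tendsto_sandwich[OF _ w_le tendsto_const])
      (use w_pos lim m(2) in \<open>auto simp: zero_power elim: eventually_mono\<close>)
  then have t0: "t \<longlonglongrightarrow> 0"
    unfolding t_def using tendsto_real_root[of w 0 sequentially 3] by simp
  have "aas r p (\<lambda>n G. \<exists>\<eta>. \<bar>\<eta>\<bar> \<le> 2 * t n \<and>
      real (turan_in G F) = (1 + \<eta>) * (p n * real (n choose r)))"
  proof (rule aasI)
    show "(\<lambda>n. 1 - (t n + (t n)\<^sup>2)) \<longlonglongrightarrow> 1" using t0 by (auto intro!: tendsto_eq_intros)
    show "eventually (\<lambda>n. 1 - (t n + (t n)\<^sup>2) \<le> measure_pmf.prob (random_rgraph r n (p n))
      {G. \<exists>\<eta>. \<bar>\<eta>\<bar> \<le> 2 * t n \<and> real (turan_in G F) = (1 + \<eta>) * (p n * real (n choose r))}) sequentially"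
      using ev_\<mu> w_pos
    proof eventually_elim
      case (elim n)
      have t: "t n > 0" "t n ^ 3 = w n" using elim by (auto simp: t_def)
      have "1 - (t n + (t n)\<^sup>2) \<le> measure_pmf.prob (random_rgraph r n (p n))
          {G. \<bar>real (turan_in G F) - \<mu> n\<bar> \<le> 2 * t n * \<mu> n}"
        using p elim t by (intro prob_turan_in_concentrated[OF F F'(1) F'_ne])
          (auto simp: \<mu>_def w_def v_def m(1))
      also have "\<dots> \<le> measure_pmf.prob (random_rgraph r n (p n))
          {G. \<exists>\<eta>. \<bar>\<eta>\<bar> \<le> 2 * t n \<and> real (turan_in G F) = (1 + \<eta>) * \<mu> n}"
      proof (rule measure_pmf.finite_measure_mono, safe)
        fix G :: "nat hgraph" assume "\<bar>real (turan_in G F) - \<mu> n\<bar> \<le> 2 * t n * \<mu> n"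
        then have "\<bar>(real (turan_in G F) - \<mu> n) / \<mu> n\<bar> \<le> 2 * t n"
          using elim by (simp add: abs_divide pos_divide_le_eq)
        moreover have "real (turan_in G F) = (1 + (real (turan_in G F) - \<mu> n) / \<mu> n) * \<mu> n"
          using elim by (simp add: field_simps)
        ultimately show "\<exists>\<eta>. \<bar>\<eta>\<bar> \<le> 2 * t n \<and> real (turan_in G F) = (1 + \<eta>) * \<mu> n" by blast
      qed simp
      finally show ?case by (simp add: \<mu>_def)
    qed
  qed
  then show ?thesis using t0 by (intro exI[of _ "\<lambda>n. 2 * t n"]) (auto intro!: tendsto_eq_intros)
qed

section \<open>The dense range\<close>

lemma prob_turan_in_ge_mono:
  assumes "edges F \<noteq> {}" "0 \<le> q" "q \<le> p" "p \<le> 1"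
  shows "measure_pmf.prob (random_rgraph r n q) {G. x \<le> real (turan_in G F)} \<le>
    measure_pmf.prob (random_rgraph r n p) {G. x \<le> real (turan_in G F)}"
proof -
  let ?U = "{T. x \<le> real (turan_in ({..<n}, T) F)}"
  have "T \<in> ?U" if "S \<in> ?U" "S \<subseteq> T" "T \<subseteq> r_sets r n" for S T
  proof -
    have "turan_in ({..<n}, S) F \<le> turan_in ({..<n}, T) F"
      using that finite_subset[OF _ finite_r_sets] assms(1) by (intro turan_in_mono) auto
    with that(1) show ?thesis by auto
  qed
  then show ?thesis
    using prob_random_subset_mono[OF finite_r_sets assms(2-4), of ?U r n]
    by (simp add: random_rgraph_eq_random_subset vimage_def)
qed

text \<open>The probability is lowered to \<open>q\<close>, slightly below the threshold \<open>n powr (-1 / d)\<close>, where the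
  deletion argument is lossless up to a factor tending to one. The factor \<open>sqrt (ln n)\<close> puts
  \<open>q\<close> in the sparse range and still leaves another \<open>sqrt (ln n)\<close> to spare against the claimed
  \<open>ln n\<close>.\<close>

lemma aas_turan_in_dense:
  fixes F :: "'a hgraph" and p :: "nat \<Rightarrow> real"
  assumes F: "rgraph r F" and deg: "max_degree F \<ge> 2"
    and p: "\<And>n. 0 \<le> p n \<and> p n \<le> 1"
    and lower: "(\<lambda>n. real n powr (- 1 / r_density r F)) \<in> o(p)"
  shows "aas r p (\<lambda>n G. real n powr (real r - 1 / r_density r F) / ln (real n) \<le> real (turan_in G F))"
proof -
  define \<alpha> where "\<alpha> = 1 / r_density r F"
  have \<alpha>: "0 < \<alpha>" "\<alpha> \<le> real r - 1" and F_ne: "edges F \<noteq> {}"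
    using r_density_properties[OF F deg] by (auto simp: \<alpha>_def subgraph_def)
  have r: "r > 0" using \<alpha> by (cases r) auto
  have minus_\<alpha>: "- 1 / r_density r F = - \<alpha>" by (simp add: \<alpha>_def)
  \<comment> \<open>The minimum keeps \<open>q\<close> below \<open>p\<close> for every \<open>n\<close>; it is the second argument for all large \<open>n\<close>.\<close>
  define q where "q n = min (p n) (real n powr (- \<alpha>) / sqrt (ln (real n)))" for n
  have ln_nonneg: "ln (real n) \<ge> 0" for n by (cases "n = 0") auto
  have q: "0 \<le> q n \<and> q n \<le> 1" for n using p[of n] ln_nonneg[of n] by (auto simp: q_def min_def)
  have ln_large: "eventually (\<lambda>n. c \<le> sqrt (ln (real n))) sequentially" for c
    by real_asymp
  have q_eq: "eventually (\<lambda>n. q n = real n powr (- \<alpha>) / sqrt (ln (real n))) sequentially"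
    using landau_o.smallD[OF lower zero_less_one] ln_large[of 1]
  proof eventually_elim
    case (elim n)
    then have "real n powr (- \<alpha>) \<le> p n" using p[of n] by (simp add: \<alpha>_def)
    moreover have "real n powr (- \<alpha>) / sqrt (ln (real n)) \<le> real n powr (- \<alpha>) / 1"
      using elim by (intro divide_left_mono) auto
    ultimately show ?case by (simp add: q_def)
  qed
  have nz: "eventually (\<lambda>n. real n powr (- \<alpha>) \<noteq> 0) sequentially"
    using eventually_gt_at_top[of 0] by eventually_elim simp
  have q_upper: "q \<in> o(\<lambda>n. real n powr (- 1 / r_density r F))"
    unfolding minus_\<alpha>
  proof (rule smalloI_tendsto[OF _ nz])
    have "(\<lambda>n. 1 / sqrt (ln (real n))) \<longlonglongrightarrow> 0" by real_asymp
    moreover have "eventually (\<lambda>n. 1 / sqrt (ln (real n)) = q n / real n powr (- \<alpha>)) sequentially"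
      using q_eq nz by eventually_elim simp
    ultimately show "(\<lambda>n. q n / real n powr (- \<alpha>)) \<longlonglongrightarrow> 0" by (rule Lim_transform_eventually)
  qed
  have q_lower: "(\<lambda>n. real n powr (- real r)) \<in> o(q)"
  proof (rule smalloI_tendsto)
    show "eventually (\<lambda>n. q n \<noteq> 0) sequentially"
      using q_eq nz ln_large[of 1] by eventually_elim auto
    have le: "eventually (\<lambda>n. real n powr (- real r) / q n \<le> sqrt (ln (real n)) / real n) sequentially"
      using q_eq eventually_gt_at_top[of 0]
    proof eventually_elim
      case (elim n)
      have "real n powr (- real r) / q n = real n powr (\<alpha> - real r) * sqrt (ln (real n))"
        unfolding elim(1) using elim(2) by (simp add: powr_minus powr_diff field_simps)
      \<comment> \<open>This uses \<open>\<alpha> \<le> r - 1\<close>.\<close>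
      also have "\<dots> \<le> real n powr (- 1) * sqrt (ln (real n))"
        using elim \<alpha> ln_nonneg by (intro mult_right_mono powr_mono) auto
      also have "\<dots> = sqrt (ln (real n)) / real n"
        using elim(2) by (simp add: powr_minus divide_simps)
      finally show ?case .
    qed
    have lim: "(\<lambda>n. sqrt (ln (real n)) / real n) \<longlonglongrightarrow> 0" by real_asymp
    show "(\<lambda>n. real n powr (- real r) / q n) \<longlonglongrightarrow> 0"
      by (rule tendsto_sandwich[OF _ le tendsto_const lim]) (simp add: q)
  qed
  obtain \<delta> :: "nat \<Rightarrow> real" where \<delta>: "\<delta> \<longlonglongrightarrow> 0" and
    conc: "aas r q (\<lambda>n G. \<exists>\<eta>. \<bar>\<eta>\<bar> \<le> \<delta> n \<and>
      real (turan_in G F) = (1 + \<eta>) * (q n * real (n choose r)))"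
    using aas_turan_in_sparse[OF F deg q q_lower q_upper] by blast
  show ?thesis
  proof (rule aasI[OF _ conc[unfolded aas_def]])
    have "eventually (\<lambda>n. \<delta> n < 1 / 2) sequentially" using \<delta> by (rule order_tendstoD) simp
    then show "eventually (\<lambda>n. measure_pmf.prob (random_rgraph r n (q n))
        {G. \<exists>\<eta>. \<bar>\<eta>\<bar> \<le> \<delta> n \<and> real (turan_in G F) = (1 + \<eta>) * (q n * real (n choose r))} \<le>
        measure_pmf.prob (random_rgraph r n (p n))
        {G. real n powr (real r - 1 / r_density r F) / ln (real n) \<le> real (turan_in G F)}) sequentially"
      using q_eq ln_large[of "2 * real r ^ r"] ln_large[of 1] eventually_gt_at_top[of 0] eventually_ge_at_top[of r]
    proof eventually_elim
      case (elim n)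
      let ?s = "sqrt (ln (real n))"
      let ?x = "real n powr (real r - 1 / r_density r F) / ln (real n)"
      have "?x = real n powr (real r - \<alpha>) / ?s * (1 / ?s)"
        using ln_nonneg[of n] by (simp add: \<alpha>_def)
      also have "\<dots> \<le> real n powr (real r - \<alpha>) / ?s * (1 / (2 * real r ^ r))"
        using elim r by (intro mult_left_mono frac_le) auto
      also have "\<dots> = 1 / 2 * (q n * (real n ^ r / real r ^ r))"
        unfolding elim(2) using \<open>0 < n\<close>
        by (simp add: powr_minus powr_diff powr_realpow field_simps)
      also have "\<dots> \<le> 1 / 2 * (q n * real (n choose r))"
        using q elim binomial_lower_bound[of r n] by (intro mult_left_mono) auto
      finally have x: "?x \<le> 1 / 2 * (q n * real (n choose r))" .
      have "?x \<le> (1 + \<eta>) * (q n * real (n choose r))" if "\<bar>\<eta>\<bar> \<le> \<delta> n" for \<eta>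
      proof (rule order_trans[OF x])
        show "1 / 2 * (q n * real (n choose r)) \<le> (1 + \<eta>) * (q n * real (n choose r))"
          using that elim q by (intro mult_right_mono) auto
      qed
      then have "measure_pmf.prob (random_rgraph r n (q n))
          {G. \<exists>\<eta>. \<bar>\<eta>\<bar> \<le> \<delta> n \<and> real (turan_in G F) = (1 + \<eta>) * (q n * real (n choose r))} \<le>
        measure_pmf.prob (random_rgraph r n (q n)) {G. ?x \<le> real (turan_in G F)}"
        by (intro measure_pmf.finite_measure_mono) auto
      also have "\<dots> \<le> measure_pmf.prob (random_rgraph r n (p n)) {G. ?x \<le> real (turan_in G F)}"
        using q p by (intro prob_turan_in_ge_mono[OF F_ne]) (auto simp: q_def)
      finally show ?case .
    qed
  qed
qed

text \<open>The random graph is intersected with a fixed extremal graph \<open>E\<close>. The intersection is \<open>F\<close>-free; its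
  size has mean \<open>p ex(n, F)\<close> and variance at most that, and Chebyshev applies with half the mean as
  the deviation.\<close>

lemma prob_turan_in_lt_half_turan_number:
  assumes "edges F \<noteq> {}" "0 \<le> p" "p \<le> 1" "p * real (turan_number r n F) > 0"
  shows "measure_pmf.prob (random_rgraph r n p)
      {G. real (turan_in G F) < p * real (turan_number r n F) / 2} \<le>
    4 / (p * real (turan_number r n F))"
proof -
  obtain E where E: "E \<subseteq> r_sets r n" "\<not> contains_copy ({..<n}, E) F" "card E = turan_number r n F"
    using turan_number_attained[OF assms(1)] .
  let ?h = "p * real (turan_number r n F)"
  let ?M = "random_subset (r_sets r n) p"
  have "T \<in> {T. ?h / 2 \<le> \<bar>real (card (T \<inter> E)) - p * real (card E)\<bar>}"
    if T: "T \<in> set_pmf ?M" "real (turan_in ({..<n}, T) F) < ?h / 2" for T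
  proof -
    have "T \<subseteq> r_sets r n" using T(1) set_random_subset by blast
    then have "finite T" "\<forall>e\<in>T. e \<subseteq> {..<n}"
      using finite_subset[OF _ finite_r_sets] by (auto simp: r_sets_def)
    moreover have "\<not> contains_copy ({..<n}, T \<inter> E) F"
      using E(2) unfolding contains_copy_def by simp blast
    ultimately have "card (T \<inter> E) \<le> turan_in ({..<n}, T) F"
      using card_le_turan_in[of "({..<n}, T)" "({..<n}, T \<inter> E)" F] by (simp add: subgraph_def)
    then show ?thesis using T(2) E(3) by simp
  qed
  then have "measure_pmf.prob ?M {T. real (turan_in ({..<n}, T) F) < ?h / 2} \<le>
      measure_pmf.prob ?M {T. ?h / 2 \<le> \<bar>real (card (T \<inter> E)) - p * real (card E)\<bar>}"
    by (intro measure_pmf.finite_measure_mono_AE) (auto simp: AE_measure_pmf_iff)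
  also have "\<dots> \<le> p * real (card E) / (?h / 2)\<^sup>2"
    using assms by (intro prob_card_deviates_le finite_r_sets E(1)) auto
  also have "\<dots> = 4 / ?h" using assms(4) E(3) by (simp add: power2_eq_square divide_simps)
  finally show ?thesis by (simp add: random_rgraph_eq_random_subset vimage_def)
qed

text \<open>The case distinction on whether the first bound is implied by the second is made for each \<open>n\<close>
  separately. In the remaining case \<open>p ex(n, F) \<ge> 2 n / ln n\<close>, so the failure probability of
  the first bound is at most \<open>2 ln n / n\<close>.\<close>

lemma aas_turan_in_dense_max:
  fixes F :: "'a hgraph" and p :: "nat \<Rightarrow> real"
  assumes F: "rgraph r F" and deg: "max_degree F \<ge> 2"
    and p: "\<And>n. 0 \<le> p n \<and> p n \<le> 1"
    and lower: "(\<lambda>n. real n powr (- 1 / r_density r F)) \<in> o(p)"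
  shows "aas r p (\<lambda>n G. real (turan_in G F) \<ge>
    max (1 / 2 * (p n * real (turan_number r n F)))
        (real n powr (real r - 1 / r_density r F) / ln (real n)))"
proof -
  define B where "B n = real n powr (real r - 1 / r_density r F) / ln (real n)" for n
  define h where "h n = p n * real (turan_number r n F)" for n
  have \<alpha>: "1 / r_density r F \<le> real r - 1" and F_ne: "edges F \<noteq> {}"
    using r_density_properties[OF F deg] by (auto simp: subgraph_def)
  let ?P = "\<lambda>n A. measure_pmf.prob (random_rgraph r n (p n)) {G. A (real (turan_in G F))}"
  have "(\<lambda>n. ?P n (\<lambda>x. B n \<le> x)) \<longlonglongrightarrow> 1"
    using aas_turan_in_dense[OF F deg p lower] by (simp add: aas_def B_def)
  moreover have "(\<lambda>n. 2 * (ln (real n) / real n)) \<longlonglongrightarrow> 0" by real_asymp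
  ultimately have lim: "(\<lambda>n. ?P n (\<lambda>x. B n \<le> x) - 2 * (ln (real n) / real n)) \<longlonglongrightarrow> 1"
    using tendsto_diff by fastforce
  have "aas r p (\<lambda>n G. max (1 / 2 * h n) (B n) \<le> real (turan_in G F))"
  proof (rule aasI[OF _ lim])
    show "eventually (\<lambda>n. ?P n (\<lambda>x. B n \<le> x) - 2 * (ln (real n) / real n) \<le>
        ?P n (\<lambda>x. max (1 / 2 * h n) (B n) \<le> x)) sequentially"
      using eventually_gt_at_top[of 1]
    proof eventually_elim
      case (elim n)
      have ln_pos: "ln (real n) > 0" using elim by simp
      show ?case
      proof (cases "1 / 2 * h n \<le> B n")
        case True
        then have "max (1 / 2 * h n) (B n) = B n" by simp
        then show ?thesis using ln_pos elim by simp
      next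
        case False
        \<comment> \<open>This uses \<open>1 / d \<le> r - 1\<close>, which makes the exponent in \<open>B\<close> at least one.\<close>
        have "real n powr 1 / ln (real n) \<le> B n"
          unfolding B_def using \<alpha> elim ln_pos by (intro divide_right_mono powr_mono) auto
        then have B: "real n / ln (real n) \<le> B n" using elim by simp
        have B_pos: "real n / ln (real n) > 0" using elim ln_pos by simp
        with B False have h: "h n > 0" "2 * (real n / ln (real n)) \<le> h n" by linarith+
        have "?P n (\<lambda>x. x < h n / 2) \<le> 4 / h n"
          using prob_turan_in_lt_half_turan_number[OF F_ne, of "p n" r n] p[of n] h(1)
          by (simp add: h_def)
        also have "\<dots> \<le> 4 / (2 * (real n / ln (real n)))"
          using h B_pos by (intro divide_left_mono mult_pos_pos) auto
        also have "\<dots> = 2 * (ln (real n) / real n)" by simp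
        finally have "?P n (\<lambda>x. x < h n / 2) \<le> 2 * (ln (real n) / real n)" .
        moreover have "?P n (\<lambda>x. B n \<le> x) \<le> measure_pmf.prob (random_rgraph r n (p n))
          ({G. max (1 / 2 * h n) (B n) \<le> real (turan_in G F)} \<union> {G. real (turan_in G F) < h n / 2})"
          by (intro measure_pmf.finite_measure_mono) auto
        moreover have "\<dots> \<le> ?P n (\<lambda>x. max (1 / 2 * h n) (B n) \<le> x) + ?P n (\<lambda>x. x < h n / 2)"
          by (rule measure_Un_le) auto
        ultimately show ?thesis by linarith
      qed
    qed
  qed
  then show ?thesis by (simp add: B_def h_def)
qed

theorem proposition2p5:
  fixes F :: "'a hgraph" and r :: nat
  assumes "rgraph r F"
    and "max_degree F \<ge> 2"
  shows "(\<forall>p :: nat \<Rightarrow> real.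
            (\<forall>n. 0 \<le> p n \<and> p n \<le> 1) \<longrightarrow>
            (\<lambda>n. real n powr (- real r)) \<in> o(p) \<longrightarrow>
            p \<in> o(\<lambda>n. real n powr (- 1 / r_density r F)) \<longrightarrow>
            (\<exists>\<delta> :: nat \<Rightarrow> real. \<delta> \<longlonglongrightarrow> 0 \<and>
               aas r p (\<lambda>n G. \<exists>\<eta>. \<bar>\<eta>\<bar> \<le> \<delta> n \<and>
                 real (turan_in G F) = (1 + \<eta>) * (p n * real (n choose r)))))
       \<and> (\<exists>c > 0. \<forall>p :: nat \<Rightarrow> real.
            (\<forall>n. 0 \<le> p n \<and> p n \<le> 1) \<longrightarrow>
            (\<lambda>n. real n powr (- 1 / r_density r F)) \<in> o(p) \<longrightarrow>
            aas r p (\<lambda>n G. real (turan_in G F) \<ge>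
              max (c * (p n * real (turan_number r n F)))
                  (real n powr (real r - 1 / r_density r F) / ln (real n))))"
  using aas_turan_in_sparse[OF assms] aas_turan_in_dense_max[OF assms]
  by (intro conjI exI[of _ "1 / 2"] allI impI) simp_all

end
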